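(* Let $\mathcal{M}$ and $\mathcal{N}$ be rank $r$ phased matroids on $[n]$, let $M\in\mathbb{C}^{r\times n}$ be a realization of $\mathcal{M}$ and $N\in\mathbb{C}^{r\times n}$ a realization of $\mathcal{N}$. If $M$ and $N$ are scaling equivalent, then $\mathcal{R}(\mathcal{M})$ is homeomorphic to $\mathcal{R}(\mathcal{N})$.
   Context: $S^1=\{z\in\mathbb{C}:|z|=1\}$; $\operatorname{ph}(z)=z/|z|$ for $z\ne0$, $\operatorname{ph}(0)=0$. A phased matroid of rank $r$ on $[n]$ is a set $\{\alpha\varphi:\alpha\in S^1\}$ with $\varphi$ a phirotope, i.e. a not identically zero alternating function $[n]^r\to S^1\cup\{0\}$ such that for all $x_1,\dots,x_{r+1},y_1,\dots,y_{r-1}$, $0$ lies in the set of phases of strictly positive real combinations of $(-1)^k\varphi(x_1,\dots,\widehat{x_k},\dots,x_{r+1})\varphi(x_k,y_1,\dots,y_{r-1})$, $k=1,\dots,r+1$. For $A\in\mathbb{C}^{r\times n}$, $\varphi_A(\lambda)=\operatorname{ph}\det$ of columns $\lambda_1,\dots,\lambda_r$ of $A$; $A$ is a realization of $\mathcal{M}$ if $\varphi_A\in\mathcal{M}$. The realization space $\mathcal{R}(\mathcal{M})$ is the set of realizations of $\mathcal{M}$ (subspace of $\mathbb{C}^{r\times n}$) modulo left multiplication by $GL(r,\mathbb{C})$, with the quotient topology. Two matrices $M,N\in\mathbb{C}^{r\times n}$ are scaling equivalent if $M=D_1ND_2$ for invertible diagonal complex matrices $D_1$ ($r\times r$) and $D_2$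 ($n\times n$), i.e. $M$ is obtained from $N$ by scaling rows and columns by nonzero complex numbers. *)

theory Defs
  imports
    "HOL-Analysis.Elementary_Metric_Spaces"
    "HOL-Analysis.Function_Topology"
    "HOL-Combinatorics.Permutations"
    "HOL-Library.NList"
    "Jordan_Normal_Form.Determinant"
begin

text \<open>
  The ground set \<open>[n]\<close> is \<open>{..<n}\<close> and an element of \<open>[n]\<^sup>r\<close> is a list of length \<open>r\<close> over it.
  Functions on \<open>[n]\<^sup>r\<close> are extensional, so that equality of functions is equality on \<open>[n]\<^sup>r\<close>.
\<close>

abbreviation tuples :: "nat \<Rightarrow> nat \<Rightarrow> nat list set" where
  "tuples r n \<equiv> nlists r {..<n}"

text \<open>The library's \<open>sgn\<close> on complex numbers is \<open>z / \<bar>z\<bar>\<close>, with \<open>sgn 0 = 0\<close>.\<close>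

abbreviation ph :: "complex \<Rightarrow> complex" where
  "ph \<equiv> sgn"

definition pos_comb_phases :: "'i set \<Rightarrow> ('i \<Rightarrow> complex) \<Rightarrow> complex set" where
  "pos_comb_phases I z =
    {ph (\<Sum>k\<in>I. complex_of_real (c k) * z k) | c :: 'i \<Rightarrow> real. \<forall>k\<in>I. c k > 0}"

definition alternating :: "nat \<Rightarrow> nat \<Rightarrow> (nat list \<Rightarrow> complex) \<Rightarrow> bool" where
  "alternating r n \<phi> \<longleftrightarrow>
    (\<forall>xs\<in>tuples r n. \<forall>\<sigma>. \<sigma> permutes {..<r} \<longrightarrow>
        \<phi> (permute_list \<sigma> xs) = of_int (sign \<sigma>) * \<phi> xs) \<and>
    (\<forall>xs\<in>tuples r n. \<not> distinct xs \<longrightarrow> \<phi> xs = 0)"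

text \<open>
  List positions start at \<open>0\<close>, so position \<open>k\<close> of \<open>xs\<close> carries the sign \<open>(-1)\<^bsup>k+1\<^esup>\<close>.
  The length of \<open>ys\<close> is constrained by \<open>Suc (length ys) = r\<close> rather than by \<open>r - 1\<close>, which would
  truncate: for \<open>r = 0\<close> there is no such \<open>ys\<close> and the condition is vacuous.
\<close>

definition phirotope :: "nat \<Rightarrow> nat \<Rightarrow> (nat list \<Rightarrow> complex) \<Rightarrow> bool" where
  "phirotope r n \<phi> \<longleftrightarrow>
    \<phi> \<in> tuples r n \<rightarrow>\<^sub>E sphere 0 1 \<union> {0} \<and>
    (\<exists>xs\<in>tuples r n. \<phi> xs \<noteq> 0) \<and>
    alternating r n \<phi> \<and>
    (\<forall>xs ys. xs \<in> tuples (Suc r) n \<and> Suc (length ys) = r \<and> set ys \<subseteq> {..<n} \<longrightarrow>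
      0 \<in> pos_comb_phases {..r}
        (\<lambda>k. (-1) ^ Suc k * \<phi> (take k xs @ drop (Suc k) xs) * \<phi> (xs ! k # ys)))"

definition phased_matroid :: "nat \<Rightarrow> nat \<Rightarrow> (nat list \<Rightarrow> complex) set \<Rightarrow> bool" where
  "phased_matroid r n \<M> \<longleftrightarrow>
    (\<exists>\<phi>. phirotope r n \<phi> \<and> \<M> = {(\<lambda>xs\<in>tuples r n. \<alpha> * \<phi> xs) | \<alpha>. \<alpha> \<in> sphere 0 1})"

definition phirotope_of_mat :: "nat \<Rightarrow> nat \<Rightarrow> complex mat \<Rightarrow> nat list \<Rightarrow> complex" where
  "phirotope_of_mat r n A = (\<lambda>xs\<in>tuples r n. ph (det (mat_of_cols r (map (col A) xs))))"

definition realizations :: "nat \<Rightarrow> nat \<Rightarrow> (nat list \<Rightarrow> complex) set \<Rightarrow> complex mat set" where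
  "realizations r n \<M> = {A \<in> carrier_mat r n. phirotope_of_mat r n A \<in> \<M>}"

text \<open>The usual topology on \<open>\<complex>\<^bsup>r \<times> n\<^esup>\<close>, transported along the identification of a matrix with its
  family of entries.\<close>

definition mat_topology :: "nat \<Rightarrow> nat \<Rightarrow> complex mat topology" where
  "mat_topology r n =
    pullback_topology (carrier_mat r n) (\<lambda>A. \<lambda>ij\<in>{..<r} \<times> {..<n}. A $$ ij)
      (product_topology (\<lambda>_. euclidean) ({..<r} \<times> {..<n}))"

definition quotient_topology :: "'a topology \<Rightarrow> ('a \<Rightarrow> 'b) \<Rightarrow> 'b topology" where
  "quotient_topology X q =
    topology (\<lambda>U. U \<subseteq> q ` topspace X \<and> openin X {x \<in> topspace X. q x \<in> U})"

lemma openin_quotient_topology: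
  "openin (quotient_topology X q) U \<longleftrightarrow>
    U \<subseteq> q ` topspace X \<and> openin X {x \<in> topspace X. q x \<in> U}"
proof -
  have "istopology (\<lambda>U. U \<subseteq> q ` topspace X \<and> openin X {x \<in> topspace X. q x \<in> U})"
    unfolding istopology_def
  proof (intro conjI allI impI)
    fix S T
    assume S: "S \<subseteq> q ` topspace X \<and> openin X {x \<in> topspace X. q x \<in> S}"
      and T: "T \<subseteq> q ` topspace X \<and> openin X {x \<in> topspace X. q x \<in> T}"
    have "{x \<in> topspace X. q x \<in> S \<inter> T} =
        {x \<in> topspace X. q x \<in> S} \<inter> {x \<in> topspace X. q x \<in> T}"
      by blast
    then show "openin X {x \<in> topspace X. q x \<in> S \<inter> T}"
      using S T by (simp add: openin_Int)
    show "S \<inter> T \<subseteq> q ` topspace X"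
      using S by blast
  next
    fix K
    assume K: "\<forall>S\<in>K. S \<subseteq> q ` topspace X \<and> openin X {x \<in> topspace X. q x \<in> S}"
    have "{x \<in> topspace X. q x \<in> \<Union>K} = \<Union>((\<lambda>S. {x \<in> topspace X. q x \<in> S}) ` K)"
      by blast
    then show "openin X {x \<in> topspace X. q x \<in> \<Union>K}"
      using K by (simp only:) (rule openin_Union, blast)
    show "\<Union>K \<subseteq> q ` topspace X"
      using K by blast
  qed
  then show ?thesis
    by (simp add: quotient_topology_def)
qed

lemma topspace_quotient_topology [simp]:
  "topspace (quotient_topology X q) = q ` topspace X"
proof
  show "topspace (quotient_topology X q) \<subseteq> q ` topspace X"
    using openin_topspace[of "quotient_topology X q"] by (simp only: openin_quotient_topology)
  have "{x \<in> topspace X. q x \<in> q ` topspace X} = topspace X"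
    by blast
  then have "openin (quotient_topology X q) (q ` topspace X)"
    by (simp add: openin_quotient_topology)
  then show "q ` topspace X \<subseteq> topspace (quotient_topology X q)"
    by (rule openin_subset)
qed

lemma quotient_map_quotient_topology: "quotient_map X (quotient_topology X q) q"
  by (simp add: quotient_map_def openin_quotient_topology)

lemma topspace_mat_topology [simp]: "topspace (mat_topology r n) = carrier_mat r n"
  by (auto simp: mat_topology_def topspace_pullback_topology)

definition GL :: "nat \<Rightarrow> complex mat set" where
  "GL r = {G \<in> carrier_mat r r. invertible_mat G}"

definition GL_orbit :: "nat \<Rightarrow> complex mat \<Rightarrow> complex mat set" where
  "GL_orbit r A = {G * A | G. G \<in> GL r}"

definition realization_space ::
    "nat \<Rightarrow> nat \<Rightarrow> (nat list \<Rightarrow> complex) set \<Rightarrow> complex mat set topology" where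
  "realization_space r n \<M> =
    quotient_topology (subtopology (mat_topology r n) (realizations r n \<M>)) (GL_orbit r)"

definition scaling_equivalent :: "nat \<Rightarrow> nat \<Rightarrow> complex mat \<Rightarrow> complex mat \<Rightarrow> bool" where
  "scaling_equivalent r n M N \<longleftrightarrow>
    (\<exists>D\<^sub>1\<in>carrier_mat r r. \<exists>D\<^sub>2\<in>carrier_mat n n.
      diagonal_mat D\<^sub>1 \<and> invertible_mat D\<^sub>1 \<and> diagonal_mat D\<^sub>2 \<and> invertible_mat D\<^sub>2 \<and>
      M = D\<^sub>1 * N * D\<^sub>2)"

end

theory Submission
  imports Defs "HOL-Analysis.Abstract_Limits"
begin

text \<open>
  If \<open>M = D\<^sub>1 N D\<^sub>2\<close>, then right multiplication by \<open>D\<^sub>2\<close> is the homeomorphism: it is linear and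
  commutes with the left action of \<open>GL r\<close>, and it multiplies the phirotope of \<^emph>\<open>every\<close> matrix by the
  same nonvanishing function of the column indices. Since all realizations of a phased matroid have
  the same phirotope up to a unit scalar, it therefore carries the realizations of \<open>\<N>\<close> exactly onto
  those of \<open>\<M>\<close>; the factor \<open>D\<^sub>1\<close> only contributes the unit scalar \<open>ph (det D\<^sub>1)\<close>.
\<close>

lemma invertible_mat_obtain_inverse:
  assumes "A \<in> carrier_mat n n" "invertible_mat A"
  obtains B where "B \<in> carrier_mat n n" "A * B = 1\<^sub>m n" "B * A = 1\<^sub>m n"
proof -
  obtain B where B: "A * B = 1\<^sub>m n" "B * A = 1\<^sub>m (dim_row B)"
    using assms by (auto simp: invertible_mat_def inverts_mat_def)
  \<comment> \<open>\<open>invertible_mat\<close> does not state the size of the inverse; comparing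
    column counts in both identities forces \<open>B\<close> to be square of size
    \<open>n\<close>.\<close>
  have "dim_col B = n" "dim_row B = n"
    using arg_cong[OF B(1), of dim_col] arg_cong[OF B(2), of dim_col] assms(1) by auto
  with B that show thesis by auto
qed

lemma det_nonzero_if_invertible_mat:
  fixes A :: "'a :: idom mat"
  assumes "A \<in> carrier_mat n n" "invertible_mat A"
  shows "det A \<noteq> 0"
proof -
  obtain B where "B \<in> carrier_mat n n" "A * B = 1\<^sub>m n"
    using invertible_mat_obtain_inverse[OF assms] by blast
  then have "det A * det B = 1"
    using det_mult[OF assms(1), of B] by simp
  then show ?thesis by auto
qed

lemma diagonal_mat_eq_mat_diag:
  assumes "D \<in> carrier_mat n n" "diagonal_mat D"
  shows "D = mat_diag n (\<lambda>i. D $$ (i, i))"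
  using assms by (intro eq_matI) (auto simp: mat_diag_def diagonal_mat_def)

lemma det_mat_diag: "det (mat_diag n f) = (\<Prod>i<n. f i)"
proof -
  have "det (mat_diag n f) = prod_list (diag_mat (mat_diag n f))"
    by (rule det_upper_triangular[of _ n]) (auto simp: mat_diag_def)
  then show ?thesis
    by (simp add: prod_list_diag_prod mat_diag_def atLeast0LessThan)
qed

text \<open>Left multiplication acts on each column separately, and the column picked at position
  \<open>i\<close> of \<open>xs\<close> carries its own scale \<open>f (xs ! i)\<close>. The
  \<open>n\<close> column scales thus become \<open>r\<close> scales of the selected square matrix,
  with repeated indices allowed.\<close>

lemma mat_of_cols_mult:
  fixes A :: "'a :: comm_ring_1 mat"
  assumes G: "G \<in> carrier_mat r r" and A: "A \<in> carrier_mat r n" and xs: "xs \<in> tuples r n"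
  shows "mat_of_cols r (map (col (G * A * mat_diag n f)) xs) =
    G * mat_of_cols r (map (col A) xs) * mat_diag r (\<lambda>i. f (xs ! i))"
proof -
  have len: "length xs = r" and lt: "\<And>j. j < r \<Longrightarrow> xs ! j < n"
    using xs nlistsE_nth_in[OF xs] by auto
  have sub: "mat_of_cols r (map (col A) xs) \<in> carrier_mat r r"
    using len by auto
  have GS: "G * mat_of_cols r (map (col A) xs) \<in> carrier_mat r r" and GA: "G * A \<in> carrier_mat r n"
    using G A sub by auto
  show ?thesis
    unfolding mat_diag_mult_right[OF GS] mat_diag_mult_right[OF GA]
    using G A sub len lt
    by (intro eq_matI) (auto simp: mat_of_cols_index scalar_prod_def)
qed

text \<open>Both \<open>det\<close> and \<open>ph\<close> are multiplicative. What matters later is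
  that the factor in front depends on \<open>G\<close>, \<open>f\<close> and \<open>xs\<close> but
  not on \<open>A\<close>.\<close>

lemma phirotope_of_mat_mult:
  assumes "G \<in> carrier_mat r r" "A \<in> carrier_mat r n" "xs \<in> tuples r n"
  shows "phirotope_of_mat r n (G * A * mat_diag n f) xs =
    ph (det G) * ph (\<Prod>i<r. f (xs ! i)) * phirotope_of_mat r n A xs"
proof -
  have S: "mat_of_cols r (map (col A) xs) \<in> carrier_mat r r"
    using assms(3) by auto
  have "det (G * mat_of_cols r (map (col A) xs) * mat_diag r (\<lambda>i. f (xs ! i))) =
      det G * det (mat_of_cols r (map (col A) xs)) * (\<Prod>i<r. f (xs ! i))"
    using assms(1) S by (simp add: det_mult[of _ r] det_mat_diag)
  then show ?thesis
    using assms
    by (simp add: phirotope_of_mat_def mat_of_cols_mult Real_Vector_Spaces.sgn_mult)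
qed

text \<open>A phased matroid is a single orbit of the unit circle, so the phirotope of any one
  realization can replace the unspecified \<open>\<phi>\<close> as its representative.\<close>

lemma realizations_eq:
  assumes "phased_matroid r n \<M>" "M \<in> realizations r n \<M>"
  shows "realizations r n \<M> = {A \<in> carrier_mat r n. \<exists>\<gamma>\<in>sphere 0 1.
    \<forall>xs\<in>tuples r n. phirotope_of_mat r n A xs = \<gamma> * phirotope_of_mat r n M xs}"
proof -
  obtain \<phi> where M: "\<M> = {(\<lambda>xs\<in>tuples r n. \<alpha> * \<phi> xs) | \<alpha>. \<alpha> \<in> sphere 0 1}"
    using assms(1) by (auto simp: phased_matroid_def)
  obtain \<beta> where \<beta>: "norm \<beta> = 1" "phirotope_of_mat r n M = (\<lambda>xs\<in>tuples r n. \<beta> * \<phi> xs)"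
    using assms(2) by (auto simp: realizations_def M)
  then have "\<beta> \<noteq> 0" by auto
  have "phirotope_of_mat r n A \<in> \<M> \<longleftrightarrow> (\<exists>\<gamma>\<in>sphere 0 1.
      \<forall>xs\<in>tuples r n. phirotope_of_mat r n A xs = \<gamma> * phirotope_of_mat r n M xs)"
    (is "_ \<longleftrightarrow> ?R") for A
  proof
    assume "phirotope_of_mat r n A \<in> \<M>"
    then obtain \<alpha> where "norm \<alpha> = 1" "phirotope_of_mat r n A = (\<lambda>xs\<in>tuples r n. \<alpha> * \<phi> xs)"
      by (auto simp: M)
    with \<beta> \<open>\<beta> \<noteq> 0\<close> show ?R
      by (intro bexI[of _ "\<alpha> / \<beta>"]) (auto simp: norm_divide)
  next
    assume ?R
    then obtain \<gamma> where \<gamma>: "norm \<gamma> = 1"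
      "\<forall>xs\<in>tuples r n. phirotope_of_mat r n A xs = \<gamma> * phirotope_of_mat r n M xs"
      by auto
    \<comment> \<open>Membership in \<open>\<M>\<close> is equality of functions, so arguments
      outside \<open>tuples r n\<close> count too; there both sides are
      \<open>undefined\<close>.\<close>
    have "phirotope_of_mat r n A = (\<lambda>xs\<in>tuples r n. (\<gamma> * \<beta>) * \<phi> xs)"
    proof
      fix xs
      show "phirotope_of_mat r n A xs = (\<lambda>xs\<in>tuples r n. (\<gamma> * \<beta>) * \<phi> xs) xs"
        using \<gamma>(2) \<beta>(2) by (cases "xs \<in> tuples r n") (simp, simp add: phirotope_of_mat_def)
    qed
    moreover have "\<gamma> * \<beta> \<in> sphere 0 1"
      using \<gamma>(1) \<beta>(1) by (simp add: norm_mult)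
    ultimately show "phirotope_of_mat r n A \<in> \<M>"
      unfolding M by blast
  qed
  then show ?thesis
    by (auto simp: realizations_def)
qed

text \<open>Membership of \<open>A * D\<close> is tested against the realization
  \<open>G * N * D\<close>, that of \<open>A\<close> against \<open>N\<close>. The two tests differ
  by a column factor common to both sides and by the unit scalar of \<open>G\<close>.\<close>

lemma mult_diagonal_mem_realizations_iff:
  assumes \<M>: "phased_matroid r n \<M>" "G * N * D \<in> realizations r n \<M>"
    and \<N>: "phased_matroid r n \<N>" "N \<in> realizations r n \<N>"
    and G: "G \<in> carrier_mat r r" "invertible_mat G"
    and D: "D \<in> carrier_mat n n" "diagonal_mat D" "invertible_mat D"
    and A: "A \<in> carrier_mat r n"
  shows "A * D \<in> realizations r n \<M> \<longleftrightarrow> A \<in> realizations r n \<N>"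
proof -
  define f where "f i = D $$ (i, i)" for i
  have Df: "D = mat_diag n f"
    unfolding f_def using D(1,2) by (rule diagonal_mat_eq_mat_diag)
  \<comment> \<open>This product is \<open>det D\<close>, so invertibility makes every diagonal
    entry nonzero.\<close>
  have "(\<Prod>i<n. f i) \<noteq> 0"
    using det_nonzero_if_invertible_mat[OF D(1,3)] by (simp add: Df det_mat_diag)
  then have f: "f i \<noteq> 0" if "i < n" for i
    using that by auto
  have c: "ph (\<Prod>i<r. f (xs ! i)) \<noteq> 0" if "xs \<in> tuples r n" for xs
    using f nlistsE_nth_in[OF that] by (auto simp: sgn_zero_iff)
  have N: "N \<in> carrier_mat r n"
    using \<N>(2) by (simp add: realizations_def)
  define g where "g = ph (det G)"
  have g: "norm g = 1" "g \<noteq> 0"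
    using det_nonzero_if_invertible_mat[OF G] by (auto simp: g_def norm_sgn sgn_zero_iff)
  have AD: "phirotope_of_mat r n (A * D) xs =
      ph (\<Prod>i<r. f (xs ! i)) * phirotope_of_mat r n A xs" if "xs \<in> tuples r n" for xs
    \<comment> \<open>The identity as left factor leaves column scaling alone, since
      \<open>ph 1 = 1\<close>.\<close>
    using phirotope_of_mat_mult[of "1\<^sub>m r" r A n xs f] that A by (simp add: Df)
  have GND: "phirotope_of_mat r n (G * N * D) xs =
      g * ph (\<Prod>i<r. f (xs ! i)) * phirotope_of_mat r n N xs" if "xs \<in> tuples r n" for xs
    using phirotope_of_mat_mult[OF G(1) N that, of f] by (simp add: Df g_def)
  have "A * D \<in> realizations r n \<M> \<longleftrightarrow> (\<exists>\<gamma>\<in>sphere 0 1. \<forall>xs\<in>tuples r n.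
      phirotope_of_mat r n (A * D) xs = \<gamma> * phirotope_of_mat r n (G * N * D) xs)"
    using A D(1) by (subst realizations_eq[OF \<M>]) auto
  also have "\<dots> \<longleftrightarrow> (\<exists>\<gamma>\<in>sphere 0 1. \<forall>xs\<in>tuples r n.
      phirotope_of_mat r n A xs = (\<gamma> * g) * phirotope_of_mat r n N xs)"
    \<comment> \<open>The factor \<open>ph (\<Prod>i<r. f (xs ! i))\<close> occurs on both sides and
      is nonzero by \<open>c\<close>, so it cancels for each \<open>xs\<close>.\<close>
    using c by (intro bex_cong ball_cong refl) (auto simp: AD GND)
  \<comment> \<open>Multiplication by the unit \<open>g\<close> permutes the circle, so
    \<open>g\<close> is absorbed into \<open>\<gamma>\<close>.\<close>
  also have "\<dots> \<longleftrightarrow> (\<exists>\<gamma>\<in>sphere 0 1. \<forall>xs\<in>tuples r n.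
      phirotope_of_mat r n A xs = \<gamma> * phirotope_of_mat r n N xs)" (is "?L \<longleftrightarrow> ?R")
  proof
    assume ?L
    then obtain \<gamma> where "norm \<gamma> = 1"
      "\<forall>xs\<in>tuples r n. phirotope_of_mat r n A xs = (\<gamma> * g) * phirotope_of_mat r n N xs"
      by auto
    then show ?R
      using g by (intro bexI[of _ "\<gamma> * g"]) (auto simp: norm_mult)
  next
    assume ?R
    then obtain \<gamma> where "norm \<gamma> = 1"
      "\<forall>xs\<in>tuples r n. phirotope_of_mat r n A xs = \<gamma> * phirotope_of_mat r n N xs"
      by auto
    then show ?L
      using g by (intro bexI[of _ "\<gamma> / g"]) (auto simp: norm_divide)
  qed
  also have "\<dots> \<longleftrightarrow> A \<in> realizations r n \<N>"
    using A by (subst realizations_eq[OF \<N>]) auto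
  finally show ?thesis .
qed

lemma continuous_map_mat_topology_entry:
  assumes "i < r" "j < n"
  shows "continuous_map (mat_topology r n) euclidean (\<lambda>A. A $$ (i, j))"
proof -
  have "continuous_map (mat_topology r n) euclidean
      ((\<lambda>x. x (i, j)) \<circ> (\<lambda>A. \<lambda>ij\<in>{..<r} \<times> {..<n}. A $$ ij))"
    unfolding mat_topology_def
    using assms by (intro continuous_map_pullback continuous_map_product_projection) auto
  then show ?thesis
    using assms by (simp add: o_def)
qed

text \<open>The target topology is pulled back from a product, so continuity is checked entry by
  entry, and each entry of \<open>A * D\<close> is a finite linear combination of entries of
  \<open>A\<close>.\<close>

lemma continuous_map_mat_topology_mult_right:
  assumes D: "D \<in> carrier_mat n m"
  shows "continuous_map (mat_topology r n) (mat_topology r m) (\<lambda>A. A * D)"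
proof -
  have entry: "continuous_map (mat_topology r n) euclidean (\<lambda>A. (A * D) $$ (i, j))"
    if "i < r" "j < m" for i j
  proof (rule continuous_map_eq)
    have "continuous_map (mat_topology r n) euclidean (\<lambda>A. A $$ (i, k) * D $$ (k, j))"
      if "k < n" for k
      using continuous_map_compose[OF continuous_map_mat_topology_entry[OF \<open>i < r\<close> that],
          of euclidean "\<lambda>z. z * D $$ (k, j)"]
      by (simp add: o_def continuous_intros)
    then show "continuous_map (mat_topology r n) euclidean
        (\<lambda>A. \<Sum>k\<in>{0..<n}. A $$ (i, k) * D $$ (k, j))"
      by (intro continuous_map_sum) auto
  qed (use that D in \<open>auto simp: scalar_prod_def\<close>)
  show ?thesis
    unfolding mat_topology_def[of r m]
  proof (rule continuous_map_pullback')
    show "continuous_map (mat_topology r n) (product_topology (\<lambda>_. euclidean) ({..<r} \<times> {..<m}))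
        ((\<lambda>A. \<lambda>ij\<in>{..<r} \<times> {..<m}. A $$ ij) \<circ> (\<lambda>A. A * D))"
      using entry by (auto simp: continuous_map_componentwise o_def)
  qed (use D in auto)
qed

text \<open>By associativity, right multiplication carries orbits to orbits. Writing the result as
  an image gives the induced map without choosing representatives.\<close>

lemma GL_orbit_mult_right:
  assumes "A \<in> carrier_mat r n" "D \<in> carrier_mat n m"
  shows "GL_orbit r (A * D) = (\<lambda>B. B * D) ` GL_orbit r A"
proof -
  have "G * (A * D) = G * A * D" if "G \<in> GL r" for G
    using that assms by (auto simp: GL_def)
  then show ?thesis
    by (force simp: GL_orbit_def)
qed

text \<open>By the universal property of the quotient, it suffices that the map is continuous after
  composition with \<open>GL_orbit r\<close>; there it agrees with right multiplication followed by
  the projection to the target.\<close>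

lemma continuous_map_realization_space_mult_right:
  assumes D: "D \<in> carrier_mat n n"
    and maps: "\<And>A. A \<in> realizations r n \<M> \<Longrightarrow> A * D \<in> realizations r n \<N>"
  shows "continuous_map (realization_space r n \<M>) (realization_space r n \<N>)
    (\<lambda>S. (\<lambda>B. B * D) ` S)"
  unfolding realization_space_def[of r n \<M>]
proof (rule continuous_compose_quotient_map[OF quotient_map_quotient_topology])
  let ?X = "subtopology (mat_topology r n) (realizations r n \<M>)"
  let ?Y = "subtopology (mat_topology r n) (realizations r n \<N>)"
  have "continuous_map ?X ?Y (\<lambda>A. A * D)"
    using continuous_map_mat_topology_mult_right[OF D, of r] maps
    by (auto simp: continuous_map_in_subtopology continuous_map_from_subtopology)
  moreover have "continuous_map ?Y (realization_space r n \<N>) (GL_orbit r)"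
    unfolding realization_space_def
    by (intro quotient_imp_continuous_map quotient_map_quotient_topology)
  ultimately have "continuous_map ?X (realization_space r n \<N>) (GL_orbit r \<circ> (\<lambda>A. A * D))"
    by (rule continuous_map_compose)
  then show "continuous_map ?X (realization_space r n \<N>) ((\<lambda>S. (\<lambda>B. B * D) ` S) \<circ> GL_orbit r)"
    by (rule continuous_map_eq) (use D in \<open>auto simp: GL_orbit_mult_right\<close>)
qed

lemma image_mult_right_inverse:
  assumes "S \<in> topspace (realization_space r n \<M>)"
    and "D \<in> carrier_mat n n" "E \<in> carrier_mat n n" "D * E = 1\<^sub>m n"
  shows "(\<lambda>B. B * E) ` (\<lambda>B. B * D) ` S = S"
proof -
  \<comment> \<open>Points of the space are orbits of \<open>r\<close> by \<open>n\<close> matrices;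
    the dimensions are what associativity requires.\<close>
  have "S \<subseteq> carrier_mat r n"
    using assms(1) by (auto simp: realization_space_def GL_orbit_def GL_def)
  then have "B * D * E = B" if "B \<in> S" for B
    using that assms by (auto simp: assoc_mult_mat[of B r n D n E n])
  then show ?thesis
    by (simp add: image_image)
qed

theorem theorem4p8:
  fixes r n :: nat
    and \<M> \<N> :: "(nat list \<Rightarrow> complex) set"
    and M N :: "complex mat"
  assumes "phased_matroid r n \<M>" and "phased_matroid r n \<N>"
    and "M \<in> realizations r n \<M>" and "N \<in> realizations r n \<N>"
    and "scaling_equivalent r n M N"
  shows "realization_space r n \<M> homeomorphic_space realization_space r n \<N>"
proof -
  obtain G D where G: "G \<in> carrier_mat r r" "invertible_mat G"
    and D: "D \<in> carrier_mat n n" "diagonal_mat D" "invertible_mat D" and M: "M = G * N * D"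
    using assms(5) by (auto simp: scaling_equivalent_def)
  obtain E where E: "E \<in> carrier_mat n n" "D * E = 1\<^sub>m n" "E * D = 1\<^sub>m n"
    using invertible_mat_obtain_inverse[OF D(1,3)] .
  have mem: "A * D \<in> realizations r n \<M> \<longleftrightarrow> A \<in> realizations r n \<N>"
    if "A \<in> carrier_mat r n" for A
    using mult_diagonal_mem_realizations_iff[OF assms(1) _ assms(2,4) G D that] assms(3) M
    by simp
  have "A * D \<in> realizations r n \<M>" if "A \<in> realizations r n \<N>" for A
    using that mem by (auto simp: realizations_def)
  moreover have "A * E \<in> realizations r n \<N>" if "A \<in> realizations r n \<M>" for A
  proof -
    have A: "A \<in> carrier_mat r n"
      using that by (simp add: realizations_def)
    \<comment> \<open>This lets \<open>mem\<close> be read backwards, at the matrix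
      \<open>A * E\<close>.\<close>
    then have "A * E * D = A"
      using D(1) E by (simp add: assoc_mult_mat[of A r n E n D n])
    then show ?thesis
      using mem[of "A * E"] A E(1) that by simp
  qed
  \<comment> \<open>Since \<open>M = G * N * D\<close>, multiplication by \<open>D\<close> leads
    from \<open>\<N>\<close> to \<open>\<M>\<close>, so the map out of \<open>\<M>\<close> uses the
    inverse \<open>E\<close>.\<close>
  ultimately have "homeomorphic_maps (realization_space r n \<M>) (realization_space r n \<N>)
      (\<lambda>S. (\<lambda>B. B * E) ` S) (\<lambda>S. (\<lambda>B. B * D) ` S)"
    unfolding homeomorphic_maps_def using D(1) E
    by (intro conjI ballI continuous_map_realization_space_mult_right image_mult_right_inverse)
  then show ?thesis
    unfolding homeomorphic_space_def by blast
qed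

end
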